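(* For all admissible $z,z'$ the point process $\mathcal P_{zz'}$ is simple; equivalently, for every $n\ge2$ the set $\{(x_1,\dots,x_n)\in I^n:\prod_{i<j}(x_i-x_j)=0\}$ is a null set for the $n$-th correlation measure of $\mathcal P_{zz'}$.
   Context: Thoma simplex $\Omega$: pairs of sequences $(\alpha|\beta)$, $\alpha_1\ge\alpha_2\ge\dots\ge0$, $\beta_1\ge\beta_2\ge\dots\ge0$, $\sum_i(\alpha_i+\beta_i)\le1$; $\Omega_0$ the subset where the sum is $1$. Admissible parameters: $z'=\bar z$, $z\notin\mathbb Z$, or $z,z'\in\mathbb R$ with $m<z,z'<m+1$ for some $m\in\mathbb Z$; $t=zz'$, $(a)_k=\Gamma(a+k)/\Gamma(a)$. $P^{(n)}_{zz'}$ is the probability measure on $\Omega_0$ supported on points $\alpha_i=(p_i+1/2)/n$, $\beta_i=(q_i+1/2)/n$ ($i\le d$), zero otherwise, with integers $p_1>\dots>p_d\ge0$, $q_1>\dots>q_d\ge0$, $\sum_i(p_i+q_i+1)=n$, of mass $\frac{n!\,t^d}{(t)_n}\prod_{i=1}^d\frac{(z+1)_{p_i}(z'+1)_{p_i}(-z+1)_{q_i}(-z'+1)_{q_i}}{(p_i!)^2(q_i!)^2}\big(\det[\frac1{p_i+q_j+1}]\big)^2$; it is known that these converge weakly to a probability measure $P_{zz'}$ on $\Omega$. The process $\mathcal P_{zz'}$: to $(\alpha|\beta)\sim P_{zz'}$ associate the configuration on $I=[-1,1]\setminus\{0\}$ of the points $\alpha_i$ ($\alpha_i\ne0$) and $-\beta_i$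 ($\beta_i\neq0$), indexed by $i$ (counted with multiplicity). Its $n$-th correlation measure assigns to a Borel $A\subset I^n$ the expected number of ordered $n$-tuples of pairwise distinct indices whose points lie in $A$. Simple means that almost surely no two indexed points coincide. *)

theory Defs
  imports "HOL-Probability.Probability"
begin

type_synonym thoma_pt = "(nat \<Rightarrow> real) \<times> (nat \<Rightarrow> real)"

definition thoma_simplex :: "thoma_pt set" where
  "thoma_simplex = {(a, b). antimono a \<and> antimono b \<and> (\<forall>i. 0 \<le> a i \<and> 0 \<le> b i) \<and>
      summable (\<lambda>i. a i + b i) \<and> (\<Sum>i. a i + b i) \<le> 1}"

definition thoma_simplex0 :: "thoma_pt set" where
  "thoma_simplex0 = {(a, b) \<in> thoma_simplex. (\<Sum>i. a i + b i) = 1}"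

definition admissible :: "complex \<Rightarrow> complex \<Rightarrow> bool" where
  "admissible z z' \<longleftrightarrow>
     (z' = cnj z \<and> z \<notin> \<int>) \<or>
     (z \<in> \<real> \<and> z' \<in> \<real> \<and> (\<exists>m::int. of_int m < Re z \<and> Re z < of_int m + 1 \<and>
                                        of_int m < Re z' \<and> Re z' < of_int m + 1))"

definition configs :: "nat \<Rightarrow> (nat list \<times> nat list) set" where
  "configs n = {(ps, qs). length ps = length qs \<and> sorted_wrt (>) ps \<and> sorted_wrt (>) qs \<and>
      sum_list ps + sum_list qs + length ps = n}"

definition cauchy_det :: "nat list \<Rightarrow> nat list \<Rightarrow> real" where
  "cauchy_det ps qs = (let d = length ps in
     (\<Sum>\<sigma> | \<sigma> permutes {..<d}. of_int (sign \<sigma>) *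
        (\<Prod>i<d. 1 / (real (ps ! i) + real (qs ! (\<sigma> i)) + 1))))"

definition config_mass :: "complex \<Rightarrow> complex \<Rightarrow> nat \<Rightarrow> nat list \<times> nat list \<Rightarrow> real" where
  "config_mass z z' n c = (let (ps, qs) = c; d = length ps; t = z * z' in
     Re (of_nat (fact n) * t ^ d / pochhammer t n *
       (\<Prod>i<d. pochhammer (z + 1) (ps ! i) * pochhammer (z' + 1) (ps ! i) *
                pochhammer (- z + 1) (qs ! i) * pochhammer (- z' + 1) (qs ! i) /
                (of_nat (fact (ps ! i)) ^ 2 * of_nat (fact (qs ! i)) ^ 2)))
     * (cauchy_det ps qs) ^ 2)"

definition config_point :: "nat \<Rightarrow> nat list \<times> nat list \<Rightarrow> thoma_pt" where
  "config_point n c = (let (ps, qs) = c in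
     (\<lambda>i. if i < length ps then (real (ps ! i) + 1/2) / real n else 0,
      \<lambda>i. if i < length qs then (real (qs ! i) + 1/2) / real n else 0))"

text \<open>P is the weak limit of P^(n)_{zz'}: integrals of bounded continuous functions converge.
  (P^(n) is the finite discrete measure, so its integral is the finite weighted sum.)\<close>
definition is_weak_limit_Pn :: "complex \<Rightarrow> complex \<Rightarrow> thoma_pt measure \<Rightarrow> bool" where
  "is_weak_limit_Pn z z' P \<longleftrightarrow>
     (\<forall>f :: thoma_pt \<Rightarrow> real. continuous_on UNIV f \<and> bounded (range f) \<longrightarrow>
        (\<lambda>n. \<Sum>c\<in>configs n. config_mass z z' n c * f (config_point n c))
          \<longlonglongrightarrow> integral\<^sup>L P f)"

text \<open>The point configuration on I = [-1,1] - {0}: index Inl i carries alpha_i (if nonzero),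
  index Inr i carries -beta_i (if nonzero).\<close>
definition pp_index :: "thoma_pt \<Rightarrow> (nat + nat) set" where
  "pp_index \<omega> = {Inl i | i. fst \<omega> i \<noteq> 0} \<union> {Inr i | i. snd \<omega> i \<noteq> 0}"

definition pp_point :: "thoma_pt \<Rightarrow> nat + nat \<Rightarrow> real" where
  "pp_point \<omega> k = (case k of Inl i \<Rightarrow> fst \<omega> i | Inr i \<Rightarrow> - snd \<omega> i)"

definition pp_simple :: "thoma_pt \<Rightarrow> bool" where
  "pp_simple \<omega> \<longleftrightarrow> (\<forall>k\<in>pp_index \<omega>. \<forall>l\<in>pp_index \<omega>. k \<noteq> l \<longrightarrow> pp_point \<omega> k \<noteq> pp_point \<omega> l)"

definition punctured_I :: "real set" where
  "punctured_I = {-1..1} - {0}"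

definition correlation_measure :: "thoma_pt measure \<Rightarrow> nat \<Rightarrow> real list set \<Rightarrow> ennreal" where
  "correlation_measure P n A = (\<integral>\<^sup>+ \<omega>. emeasure (count_space UNIV)
       {ks :: (nat + nat) list. length ks = n \<and> distinct ks \<and> set ks \<subseteq> pp_index \<omega> \<and>
          map (pp_point \<omega>) ks \<in> A} \<partial>P)"

definition diagonal_set :: "nat \<Rightarrow> real list set" where
  "diagonal_set n = {xs. length xs = n \<and> set xs \<subseteq> punctured_I \<and>
      (\<Prod>i<n. \<Prod>j\<in>{i<..<n}. xs ! i - xs ! j) = 0}"

end

theory Submission
  imports Defs "Jordan_Normal_Form.Determinant"
begin

text \<open>Fix an index \<open>a\<close>. Adding \<open>n\<close> to each of the \<open>Suc a\<close> largest Frobenius coordinates \<open>p\<close> is an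
  injection from the configurations of size \<open>n\<close> into those of size \<open>n + Suc a * n\<close>.
  When \<open>p\<^sub>a \<ge> \<epsilon> n\<close>, the product form of the Cauchy determinant shows that every factor of the mass
  decreases at most by a constant depending on \<open>\<epsilon>\<close> and \<open>a\<close>, except that the repulsion factor
  of two neighbours at distance at most \<open>\<delta> n\<close> gains at least of order \<open>\<delta>\<^sup>-\<^sup>2\<close>. Since the total mass at
  size \<open>n + Suc a * n\<close> tends to 1, the event that coordinates \<open>a\<close> and \<open>Suc a\<close> are \<open>\<delta>\<close>-close and larger
  than \<open>\<epsilon>\<close> has mass \<open>O(\<delta>\<^sup>2)\<close> uniformly in large \<open>n\<close>. This bound survives the weak limit, and
  letting \<open>\<delta> \<rightarrow> 0\<close> excludes coincidences of the \<open>\<alpha>\<close>'s. The \<open>\<beta>\<close>'s follow by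
  the symmetry \<open>(z, p, q) \<mapsto> (-z, q, p)\<close>.\<close>

section \<open>The Cauchy determinant\<close>

lemma det_mat_diag:
  fixes f :: "nat \<Rightarrow> real"
  shows "Determinant.det (mat_diag n f) = (\<Prod>i<n. f i)"
proof -
  have "Determinant.det (mat_diag n f) = prod_list (diag_mat (mat_diag n f))"
    by (rule Determinant.det_upper_triangular[of _ n]) (auto simp: mat_diag_def)
  also have "diag_mat (mat_diag n f) = map f [0..<n]"
    by (auto simp: diag_mat_def mat_diag_def intro!: map_cong)
  finally show ?thesis
    by (simp add: prod.distinct_set_conv_list[symmetric] lessThan_atLeast0)
qed

definition cauchy_mat :: "(nat \<Rightarrow> real) \<Rightarrow> (nat \<Rightarrow> real) \<Rightarrow> nat \<Rightarrow> real Matrix.mat" where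
  "cauchy_mat x y n = Matrix.mat n n (\<lambda>(i, j). 1 / (x i + y j))"

text \<open>The Schur complement of the last entry of a Cauchy matrix is the smaller Cauchy matrix,
  rescaled along rows and columns.\<close>

lemma cauchy_mat_Suc:
  assumes nz: "\<And>i j. i \<le> n \<Longrightarrow> j \<le> n \<Longrightarrow> x i + y j \<noteq> 0"
  shows "cauchy_mat x y (Suc n) =
    four_block_mat (mat_diag n (\<lambda>i. (x i - x n) / (x i + y n)) * cauchy_mat x y n)
        (Matrix.mat n 1 (\<lambda>(i, j). 1 / (x i + y n)))
        (0\<^sub>m 1 n) (Matrix.mat 1 1 (\<lambda>_. 1 / (x n + y n)))
    * four_block_mat (mat_diag n (\<lambda>j. (y j - y n) / (x n + y j))) (0\<^sub>m n 1)
        (Matrix.mat 1 n (\<lambda>(i, j). (x n + y n) / (x n + y j))) (1\<^sub>m 1)"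
    (is "_ = four_block_mat (?D1 * _) ?b _ ?d * four_block_mat ?D2 _ ?c _")
proof -
  let ?C = "cauchy_mat x y n"
  have C: "?C \<in> carrier_mat n n" by (simp add: cauchy_mat_def)
  have DC: "?D1 * ?C \<in> carrier_mat n n" by (rule mult_carrier_mat[OF mat_diag_dim C])
  have scaled: "?D1 * ?C * ?D2 = Matrix.mat n n (\<lambda>(i, j).
      (x i - x n) / (x i + y n) * (1 / (x i + y j)) * ((y j - y n) / (x n + y j)))"
    by (subst mat_diag_mult_left[OF C], subst mat_diag_mult_right[of _ n n])
      (auto simp: cauchy_mat_def)
  have bc: "?b * ?c = Matrix.mat n n (\<lambda>(i, j). 1 / (x i + y n) * ((x n + y n) / (x n + y j)))"
    by (rule eq_matI) (auto simp: scalar_prod_def)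
  have dc: "?d * ?c = Matrix.mat 1 n (\<lambda>(i, j). 1 / (x n + y j))"
    using nz by (intro eq_matI) (auto simp: scalar_prod_def)
  have schur: "(x i - x n) / (x i + y n) * (1 / (x i + y j)) * ((y j - y n) / (x n + y j))
      + 1 / (x i + y n) * ((x n + y n) / (x n + y j)) = 1 / (x i + y j)"
    if "i < n" "j < n" for i j
  proof -
    have "x i + y n \<noteq> 0" "x i + y j \<noteq> 0" "x n + y j \<noteq> 0"
      using nz that by auto
    then show ?thesis by (simp add: divide_simps) (simp add: algebra_simps)
  qed
  have "four_block_mat (?D1 * ?C) ?b (0\<^sub>m 1 n) ?d * four_block_mat ?D2 (0\<^sub>m n 1) ?c (1\<^sub>m 1) =
     four_block_mat (?D1 * ?C * ?D2 + ?b * ?c) ((?D1 * ?C) * 0\<^sub>m n 1 + ?b * 1\<^sub>m 1)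
      (0\<^sub>m 1 n * ?D2 + ?d * ?c) (0\<^sub>m 1 n * 0\<^sub>m n 1 + ?d * 1\<^sub>m 1)"
    by (rule mult_four_block_mat[OF DC]) auto
  also have "\<dots> = four_block_mat ?C ?b (Matrix.mat 1 n (\<lambda>(i, j). 1 / (x n + y j))) ?d"
  proof -
    have 1: "?D1 * ?C * ?D2 + ?b * ?c = ?C"
      unfolding scaled bc using schur by (intro eq_matI) (auto simp: cauchy_mat_def)
    have 2: "(?D1 * ?C) * 0\<^sub>m n 1 + ?b * 1\<^sub>m 1 = ?b"
      by (subst right_mult_zero_mat[OF DC]) auto
    have 3: "0\<^sub>m 1 n * ?D2 + ?d * ?c = Matrix.mat 1 n (\<lambda>(i, j). 1 / (x n + y j))"
      unfolding dc by (subst left_mult_zero_mat[of _ n n]) auto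
    have 4: "0\<^sub>m 1 n * 0\<^sub>m n 1 + ?d * 1\<^sub>m 1 = ?d"
      by (subst left_mult_zero_mat[of _ n 1]) auto
    show ?thesis unfolding 1 2 3 4 ..
  qed
  also have "\<dots> = cauchy_mat x y (Suc n)"
    by (rule eq_matI) (auto simp: cauchy_mat_def less_Suc_eq)
  finally show ?thesis ..
qed

text \<open>Both factors of the block factorisation are block triangular, so passing from
  \<open>n\<close> to \<open>Suc n\<close> multiplies the determinant by two diagonal products and
  the corner \<open>1 / (x n + y n)\<close>. These are exactly the new factors of the product
  formula.\<close>

lemma det_cauchy_mat:
  assumes "\<And>i j. i < n \<Longrightarrow> j < n \<Longrightarrow> x i + y j \<noteq> 0"
  shows "Determinant.det (cauchy_mat x y n) =
    (\<Prod>i<n. \<Prod>j<i. (x j - x i) * (y j - y i)) / (\<Prod>i<n. \<Prod>j<n. x i + y j)"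
  using assms
proof (induction n)
  case 0
  show ?case by (simp add: cauchy_mat_def)
next
  case (Suc n)
  let ?C = "cauchy_mat x y n"
  have C: "?C \<in> carrier_mat n n" by (simp add: cauchy_mat_def)
  let ?D1 = "mat_diag n (\<lambda>i. (x i - x n) / (x i + y n))"
  let ?D2 = "mat_diag n (\<lambda>j. (y j - y n) / (x n + y j))"
  let ?b = "Matrix.mat n 1 (\<lambda>(i, j). 1 / (x i + y n))"
  let ?c = "Matrix.mat 1 n (\<lambda>(i, j). (x n + y n) / (x n + y j))"
  let ?d = "Matrix.mat 1 1 (\<lambda>_. 1 / (x n + y n))"
  have DC: "?D1 * ?C \<in> carrier_mat n n" by (rule mult_carrier_mat[OF mat_diag_dim C])
  have "Determinant.det (cauchy_mat x y (Suc n)) =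
     Determinant.det (four_block_mat (?D1 * ?C) ?b (0\<^sub>m 1 n) ?d) *
     Determinant.det (four_block_mat ?D2 (0\<^sub>m n 1) ?c (1\<^sub>m 1))"
    using Suc.prems DC
    by (subst cauchy_mat_Suc) (auto intro!: Determinant.det_mult[where n = "Suc n"]
        four_block_carrier_mat[of _ n n _ 1 1, simplified])
  also have "Determinant.det (four_block_mat (?D1 * ?C) ?b (0\<^sub>m 1 n) ?d) =
      Determinant.det (?D1 * ?C) * Determinant.det ?d"
    by (rule det_four_block_mat_lower_left_zero[OF DC]) auto
  also have "Determinant.det (?D1 * ?C) = Determinant.det ?D1 * Determinant.det ?C"
    by (rule Determinant.det_mult[OF _ C]) auto
  also have "Determinant.det ?d = 1 / (x n + y n)"
    by (simp add: det_single)
  also have "Determinant.det (four_block_mat ?D2 (0\<^sub>m n 1) ?c (1\<^sub>m 1)) =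
      Determinant.det ?D2 * Determinant.det (1\<^sub>m 1)"
    by (rule det_four_block_mat_upper_right_zero) auto
  finally have "Determinant.det (cauchy_mat x y (Suc n)) =
      (\<Prod>i<n. (x i - x n) / (x i + y n)) * Determinant.det ?C * (1 / (x n + y n)) *
      (\<Prod>j<n. (y j - y n) / (x n + y j))"
    by (simp add: det_mat_diag)
  also have "Determinant.det ?C =
    (\<Prod>i<n. \<Prod>j<i. (x j - x i) * (y j - y i)) / (\<Prod>i<n. \<Prod>j<n. x i + y j)"
    using Suc by simp
  finally show ?case
    by (simp add: prod_dividef prod.distrib mult_ac)
qed

text \<open>The 1 in the denominators is absorbed into the nodes \<open>real (qs ! j) + 1\<close>.
  All sums of nodes are then positive, so the product formula applies to arbitrary natural
  entries.\<close>

lemma cauchy_det_eq: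
  assumes "length ps = length qs"
  shows "cauchy_det ps qs = (\<Prod>i<length ps. \<Prod>j<i.
      (real (ps ! j) - real (ps ! i)) * (real (qs ! j) - real (qs ! i))) /
    (\<Prod>i<length ps. \<Prod>j<length ps. real (ps ! i) + real (qs ! j) + 1)"
proof -
  let ?M = "cauchy_mat (\<lambda>i. real (ps ! i)) (\<lambda>j. real (qs ! j) + 1) (length ps)"
  have "cauchy_det ps qs = Determinant.det ?M"
    unfolding cauchy_det_def Let_def Determinant.det_def
    by (auto simp: cauchy_mat_def lessThan_atLeast0 permutes_in_image add.assoc
        intro!: sum.cong prod.cong)
  also have "\<dots> = (\<Prod>i<length ps. \<Prod>j<i.
      (real (ps ! j) - real (ps ! i)) * (real (qs ! j) - real (qs ! i))) /
    (\<Prod>i<length ps. \<Prod>j<length ps. real (ps ! i) + real (qs ! j) + 1)"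
    by (subst det_cauchy_mat) (auto simp: add.assoc add_eq_0_iff)
  finally show ?thesis .
qed

section \<open>Configurations and their masses\<close>

lemma finite_configs: "finite (configs n)"
proof (rule finite_subset)
  let ?L = "{xs :: nat list. set xs \<subseteq> {..n} \<and> length xs \<le> n}"
  show "configs n \<subseteq> ?L \<times> ?L"
  proof safe
    fix ps qs assume "(ps, qs) \<in> configs n"
    then have *: "length ps = length qs" "sum_list ps + sum_list qs + length ps = n"
      by (auto simp: configs_def)
    show "length ps \<le> n" "length qs \<le> n" using * by auto
    show "x \<le> n" if "x \<in> set ps" for x
      using member_le_sum_list[OF that] * by simp
    show "x \<le> n" if "x \<in> set qs" for x
      using member_le_sum_list[OF that] * by simp
  qed
  show "finite (?L \<times> ?L)" by (intro finite_cartesian_product finite_lists_length_le) auto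
qed

section \<open>Raising the largest Frobenius coordinates\<close>

definition shift_list :: "nat \<Rightarrow> nat \<Rightarrow> nat list \<Rightarrow> nat list" where
  "shift_list a k ps = map (\<lambda>l. if l \<le> a then ps ! l + k else ps ! l) [0..<length ps]"

lemma length_shift_list [simp]: "length (shift_list a k ps) = length ps"
  by (simp add: shift_list_def)

lemma nth_shift_list:
  "l < length ps \<Longrightarrow> shift_list a k ps ! l = (if l \<le> a then ps ! l + k else ps ! l)"
  by (simp add: shift_list_def)

text \<open>Positions, not values, decide which entries move, so the shift is undone by subtracting
  \<open>k\<close> at the same positions.\<close>

lemma inj_shift_list: "inj (shift_list a k)"
proof (rule injI)
  fix ps qs assume eq: "shift_list a k ps = shift_list a k qs"
  then have len: "length ps = length qs" by (metis length_shift_list)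
  show "ps = qs"
  proof (rule nth_equalityI[OF len])
    fix l assume l: "l < length ps"
    have "shift_list a k ps ! l = shift_list a k qs ! l" using eq by simp
    with l len show "ps ! l = qs ! l" by (auto simp: nth_shift_list split: if_splits)
  qed
qed

text \<open>The first \<open>Suc a\<close> entries of a decreasing list are its largest, so raising
  them equally keeps the order strict. Each contributes \<open>k\<close> to the size.\<close>

lemma shift_list_in_configs:
  assumes "(ps, qs) \<in> configs n" "a < length ps"
  shows "(shift_list a k ps, qs) \<in> configs (n + Suc a * k)"
proof -
  have "sum_list (shift_list a k ps) = (\<Sum>l<length ps. if l \<le> a then ps ! l + k else ps ! l)"
    by (auto simp: sum_list_sum_nth lessThan_atLeast0 nth_shift_list intro!: sum.cong)
  also have "\<dots> = (\<Sum>l<length ps. ps ! l + (if l \<le> a then k else 0))"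
    by (intro sum.cong) auto
  also have "\<dots> = sum_list ps + (\<Sum>l<length ps. if l \<le> a then k else 0)"
    by (simp add: sum.distrib sum_list_sum_nth lessThan_atLeast0)
  also have "(\<Sum>l<length ps. if l \<le> a then k else 0) = (\<Sum>l\<in>{..a}. k)"
    using assms(2) by (intro sum.mono_neutral_cong_right) auto
  finally have "sum_list (shift_list a k ps) = sum_list ps + Suc a * k" by simp
  moreover have "sorted_wrt (>) (shift_list a k ps)"
    unfolding sorted_wrt_iff_nth_less
  proof (intro allI impI)
    fix i j assume ij: "i < j" "j < length (shift_list a k ps)"
    then have "ps ! i > ps ! j"
      using assms(1) by (auto simp: configs_def sorted_wrt_iff_nth_less)
    with ij show "shift_list a k ps ! i > shift_list a k ps ! j" by (simp add: nth_shift_list)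
  qed
  ultimately show ?thesis using assms(1) by (auto simp: configs_def)
qed

section \<open>Positivity from admissibility and the real form of the masses\<close>

text \<open>For conjugate parameters the product is a squared modulus, nonzero because
  \<open>z\<close> is not an integer. For real ones no integer separates \<open>z\<close> from
  \<open>z'\<close>, so both factors have the same sign.\<close>

lemma admissible_shift_pos:
  assumes "admissible z z'"
  shows "\<exists>r>0. (z + of_int j) * (z' + of_int j) = of_real r"
proof -
  consider "z' = cnj z" "z \<notin> \<int>" |
    m :: int where "z \<in> \<real>" "z' \<in> \<real>" "of_int m < Re z" "Re z < of_int m + 1"
      "of_int m < Re z'" "Re z' < of_int m + 1"
    using assms by (auto simp: admissible_def)
  then show ?thesis
  proof cases
    case 1
    have "z + of_int j \<noteq> 0"
    proof
      assume "z + of_int j = 0"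
      then have "z = of_int (- j)" by (simp add: eq_neg_iff_add_eq_0)
      with 1 show False by simp
    qed
    moreover have "(z + of_int j) * (z' + of_int j) = of_real ((cmod (z + of_int j))\<^sup>2)"
      using 1 complex_norm_square[of "z + of_int j"] by simp
    ultimately show ?thesis by (intro exI[of _ "(cmod (z + of_int j))\<^sup>2"]) simp
  next
    case (2 m)
    then obtain x y where z: "z = of_real x" "z' = of_real y" by (auto elim!: Reals_cases)
    have "0 < (x + j) * (y + j)"
    proof (cases "m + j \<ge> 0")
      case True
      then have "real_of_int m + real_of_int j \<ge> 0" by linarith
      then show ?thesis using 2 z by (intro mult_pos_pos) auto
    next
      case False
      then have "real_of_int m + 1 + real_of_int j \<le> 0" by linarith
      then show ?thesis using 2 z by (intro mult_neg_neg) auto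
    qed
    then show ?thesis by (intro exI[of _ "(x + j) * (y + j)"]) (simp add: z)
  qed
qed

lemma admissible_uminus:
  assumes "admissible z z'"
  shows "admissible (- z) (- z')"
proof -
  have "\<exists>n::int. of_int n < - x \<and> - x < of_int n + 1 \<and> of_int n < - y \<and> - y < of_int n + 1"
    if "of_int m < x" "x < of_int m + 1" "of_int m < y" "y < of_int m + 1" for m :: int and x y :: real
    using that by (intro exI[of _ "- m - 1"]) simp
  with assms show ?thesis unfolding admissible_def by (auto simp: minus_in_Ints_iff)
qed

text \<open>The mass depends on \<open>z\<close> and \<open>z'\<close> only through their sum and
  product, so all estimates can be made with real numbers. Positivity at positive \<open>j\<close>
  serves the weights of \<open>ps\<close>, at negative \<open>j\<close> those of
  \<open>qs\<close>.\<close>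

lemma admissible_real:
  assumes "admissible z z'"
  obtains s t :: real where "z + z' = of_real s" "z * z' = of_real t" "t > 0"
    "\<And>j :: int. 0 < (of_int j)\<^sup>2 + s * of_int j + t"
proof -
  obtain t where t: "t > 0" "z * z' = of_real t"
    using admissible_shift_pos[OF assms, of 0] by auto
  obtain r where r: "(z + 1) * (z' + 1) = of_real r"
    using admissible_shift_pos[OF assms, of 1] by auto
  \<comment> \<open>The product at shift 1 is \<open>z * z' + (z + z') + 1\<close>, which shows that
    the sum is real and gives its value.\<close>
  define s where "s = r - t - 1"
  have "z + z' = (z + 1) * (z' + 1) - z * z' - 1" by (simp add: algebra_simps)
  then have s: "z + z' = of_real s" by (simp add: r t s_def)
  have "0 < (of_int j)\<^sup>2 + s * of_int j + t" for j :: int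
  proof -
    obtain q where q: "q > 0" "(z + of_int j) * (z' + of_int j) = of_real q"
      using admissible_shift_pos[OF assms] by blast
    have "(z + of_int j) * (z' + of_int j) = (of_int j)\<^sup>2 + (z + z') * of_int j + z * z'"
      by (simp add: algebra_simps power2_eq_square)
    also have "\<dots> = of_real ((of_int j)\<^sup>2 + s * of_int j + t)" by (simp add: s t)
    finally show ?thesis using q by (metis of_real_eq_iff)
  qed
  with s t show ?thesis using that by blast
qed

text \<open>The factor \<open>(z + 1)\<^sub>p (z' + 1)\<^sub>p / (p!)\<^sup>2\<close>, written with \<open>s = z + z'\<close> and \<open>t = z z'\<close>.\<close>

definition weight :: "real \<Rightarrow> real \<Rightarrow> nat \<Rightarrow> real" where
  "weight s t p = (\<Prod>j=1..p. 1 + s / real j + t / (real j)\<^sup>2)"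

lemma weight_0 [simp]: "weight s t 0 = 1"
  by (simp add: weight_def)

lemma weight_Suc:
  "weight s t (Suc p) = weight s t p * (1 + s / real (Suc p) + t / (real (Suc p))\<^sup>2)"
  by (simp add: weight_def)

lemma weight_pos:
  assumes "\<And>j :: int. 0 < (of_int j)\<^sup>2 + s * of_int j + t"
  shows "0 < weight s t p"
  unfolding weight_def
proof (rule prod_pos)
  fix j assume "j \<in> {1..p}"
  then have j: "real j > 0" by simp
  have "1 + s / real j + t / (real j)\<^sup>2 = ((real j)\<^sup>2 + s * real j + t) / (real j)\<^sup>2"
    using j by (simp add: field_simps power2_eq_square)
  then show "0 < 1 + s / real j + t / (real j)\<^sup>2"
    using j assms[of "int j"] by simp
qed

text \<open>Taking the square of \<open>j\<close> out of \<open>(z + j) * (z' + j)\<close> leaves a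
  factor of \<open>weight\<close>; the extracted squares multiply to
  \<open>(fact p)\<^sup>2\<close>.\<close>

lemma pochhammer_mult_eq_weight:
  fixes z z' :: complex
  assumes "z + z' = of_real s" "z * z' = of_real t"
  shows "pochhammer (z + 1) p * pochhammer (z' + 1) p = of_real (weight s t p * (fact p)\<^sup>2)"
proof (induction p)
  case (Suc p)
  let ?q = "real (Suc p)"
  have "pochhammer (z + 1) (Suc p) * pochhammer (z' + 1) (Suc p) =
      (pochhammer (z + 1) p * pochhammer (z' + 1) p) * ((z + of_nat (Suc p)) * (z' + of_nat (Suc p)))"
    by (simp add: pochhammer_Suc algebra_simps)
  also have "(z + of_nat (Suc p)) * (z' + of_nat (Suc p)) =
      (of_nat (Suc p))\<^sup>2 + (z + z') * of_nat (Suc p) + z * z'"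
    by (simp only: algebra_simps power2_eq_square)
  also have "\<dots> = of_real (?q\<^sup>2 + s * ?q + t)"
    by (simp add: assms)
  also have "?q\<^sup>2 + s * ?q + t = (1 + s / ?q + t / ?q\<^sup>2) * ?q\<^sup>2"
    by (simp add: field_simps power2_eq_square del: of_nat_Suc)
  finally show ?case
    unfolding Suc.IH by (simp add: weight_Suc power_mult_distrib mult_ac del: of_nat_Suc)
qed simp

text \<open>The weights of \<open>ps\<close> and \<open>qs\<close> are kept in separate products
  because the shift affects only the former.\<close>

definition real_mass :: "real \<Rightarrow> real \<Rightarrow> nat \<Rightarrow> nat list \<times> nat list \<Rightarrow> real" where
  "real_mass s t n = (\<lambda>(ps, qs). fact n / pochhammer t n * t ^ length ps *
     (\<Prod>i<length ps. weight s t (ps ! i)) * (\<Prod>i<length ps. weight (- s) t (qs ! i)) *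
     (cauchy_det ps qs)\<^sup>2)"

lemma config_mass_eq_real_mass:
  assumes "z + z' = of_real s" "z * z' = of_real t"
  shows "config_mass z z' n c = real_mass s t n c"
proof -
  obtain ps qs where c: "c = (ps, qs)" by fastforce
  \<comment> \<open>The \<open>qs\<close> factors are the \<open>ps\<close> factors for the
    parameters \<open>- z\<close> and \<open>- z'\<close>.\<close>
  have neg: "- z + - z' = of_real (- s)" "(- z) * (- z') = of_real t"
    using assms by (auto simp: algebra_simps minus_equation_iff)
  have "pochhammer (z + 1) p * pochhammer (z' + 1) p * pochhammer (- z + 1) q * pochhammer (- z' + 1) q /
      (of_nat (fact p) ^ 2 * of_nat (fact q) ^ 2) = complex_of_real (weight s t p * weight (- s) t q)" for p q
  proof -
    have "pochhammer (z + 1) p * pochhammer (z' + 1) p * pochhammer (- z + 1) q * pochhammer (- z' + 1) q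
      = of_real (weight s t p * (fact p)\<^sup>2) * of_real (weight (- s) t q * (fact q)\<^sup>2)"
      unfolding pochhammer_mult_eq_weight[OF assms, symmetric]
        pochhammer_mult_eq_weight[OF neg, symmetric] by (simp add: mult_ac)
    then show ?thesis by simp
  qed
  then have "config_mass z z' n c = Re (of_nat (fact n) * of_real t ^ length ps / pochhammer (of_real t) n *
      (\<Prod>i<length ps. of_real (weight s t (ps ! i) * weight (- s) t (qs ! i)))) * (cauchy_det ps qs)\<^sup>2"
    by (simp add: config_mass_def c assms Let_def)
  also have "of_nat (fact n) * of_real t ^ length ps / pochhammer (of_real t) n *
      (\<Prod>i<length ps. of_real (weight s t (ps ! i) * weight (- s) t (qs ! i))) =
      complex_of_real (fact n * t ^ length ps / pochhammer t n *
      (\<Prod>i<length ps. weight s t (ps ! i) * weight (- s) t (qs ! i)))"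
    by (simp add: pochhammer_of_real)
  finally show ?thesis
    unfolding Re_complex_of_real by (simp add: c real_mass_def prod.distrib mult_ac)
qed

section \<open>Loss of the weights and of the prefactor under growth\<close>

text \<open>One further factor is at least \<open>1 - \<bar>s\<bar> / j\<close>, since
  \<open>t\<close> only helps, and so costs at most the exponential shown. Over \<open>m\<close>
  steps with \<open>m\<close> of order \<open>p\<close> the total cost stays bounded.\<close>

lemma weight_le_weight_add:
  assumes pos: "\<And>j :: int. 0 < (of_int j)\<^sup>2 + s * of_int j + t" and "t > 0" and p: "2 * \<bar>s\<bar> \<le> real p"
  shows "weight s t p \<le> exp (2 * \<bar>s\<bar> / (real p + 1)) ^ m * weight s t (p + m)"
proof (induction m)
  case (Suc m)
  define j where "j = real (Suc (p + m))"
  define x where "x = \<bar>s\<bar> / j"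
  have j: "j > 0" "real p + 1 \<le> j" by (auto simp: j_def)
  have x: "0 \<le> x" "x \<le> 1/2" using j p by (auto simp: x_def field_simps)
  \<comment> \<open>The right side is \<open>1 + x * (1 - 2 * x)\<close>, hence the condition
    \<open>x \<le> 1/2\<close>, which the lower bound on \<open>p\<close> provides.\<close>
  have "1 \<le> (1 + 2 * x) * (1 - x)"
    using x mult_right_mono[of "2 * x" 1 x] by (simp add: algebra_simps)
  also have "\<dots> \<le> exp (2 * \<bar>s\<bar> / (real p + 1)) * (1 + s / j + t / j\<^sup>2)"
  proof (rule mult_mono)
    have "1 + 2 * x \<le> exp (2 * x)" by simp
    also have "2 * x \<le> 2 * \<bar>s\<bar> / (real p + 1)"
      unfolding x_def using j by (simp add: frac_le)
    finally show "1 + 2 * x \<le> exp (2 * \<bar>s\<bar> / (real p + 1))" by simp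
    have "- (\<bar>s\<bar> / j) \<le> s / j" using j by (simp add: field_simps)
    moreover have "t / j\<^sup>2 \<ge> 0" using \<open>t > 0\<close> by simp
    ultimately show "1 - x \<le> 1 + s / j + t / j\<^sup>2" unfolding x_def by linarith
  qed (use x in auto)
  finally have *: "1 \<le> exp (2 * \<bar>s\<bar> / (real p + 1)) * (1 + s / j + t / j\<^sup>2)" .
  have "weight s t p \<le> exp (2 * \<bar>s\<bar> / (real p + 1)) ^ m * weight s t (p + m)" by (rule Suc.IH)
  also have "\<dots> = exp (2 * \<bar>s\<bar> / (real p + 1)) ^ m * weight s t (p + m) * 1" by simp
  also have "\<dots> \<le> exp (2 * \<bar>s\<bar> / (real p + 1)) ^ m * weight s t (p + m) *
      (exp (2 * \<bar>s\<bar> / (real p + 1)) * (1 + s / j + t / j\<^sup>2))"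
    using weight_pos[OF pos] by (intro mult_left_mono *) (simp add: less_imp_le)
  also have "\<dots> = exp (2 * \<bar>s\<bar> / (real p + 1)) ^ Suc m * weight s t (p + Suc m)"
    by (simp add: weight_Suc j_def mult_ac del: of_nat_Suc)
  finally show ?case .
qed simp

text \<open>One step divides the quotient by
  \<open>(t + j) / (j + 1) = 1 + (t - 1) / (j + 1)\<close>, which is at most the given exponential.
  The loss is bounded when \<open>m\<close> is a fixed multiple of \<open>n\<close>.\<close>

lemma fact_div_pochhammer_le:
  fixes t :: real
  assumes "t > 0"
  shows "fact n / pochhammer t n \<le>
    exp (\<bar>t - 1\<bar> / (real n + 1)) ^ m * (fact (n + m) / pochhammer t (n + m))"
proof (induction m)
  case (Suc m)
  define j where "j = real (n + m)"
  let ?e = "exp (\<bar>t - 1\<bar> / (real n + 1))"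
  have j: "real n \<le> j" "0 \<le> j" by (auto simp: j_def)
  have "(t + j) / (j + 1) = 1 + (t - 1) / (j + 1)"
    using j by (simp add: field_simps)
  also have "\<dots> \<le> exp ((t - 1) / (j + 1))" by simp
  also have "(t - 1) / (j + 1) \<le> \<bar>t - 1\<bar> / (real n + 1)"
    using j by (intro frac_le) auto
  finally have "(t + j) / (j + 1) \<le> ?e" by simp
  then have *: "1 \<le> ?e * ((j + 1) / (t + j))"
    using j assms by (simp add: field_simps)
  have "fact n / pochhammer t n \<le> ?e ^ m * (fact (n + m) / pochhammer t (n + m)) * 1"
    using Suc.IH by simp
  also have "\<dots> \<le> ?e ^ m * (fact (n + m) / pochhammer t (n + m)) * (?e * ((j + 1) / (t + j)))"
    using pochhammer_pos[OF assms] by (intro mult_left_mono *) (simp add: less_imp_le)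
  also have "\<dots> = ?e ^ Suc m * (fact (n + Suc m) / pochhammer t (n + Suc m))"
    by (simp add: pochhammer_Suc j_def mult_ac add_ac)
  finally show ?case .
qed simp

section \<open>Comparison of masses under the shift\<close>

text \<open>Pads the triangular Vandermonde product with ones to a full square, so that it can be
  merged with the square product of denominators.\<close>

lemma prod_triangle_eq:
  fixes f :: "nat \<Rightarrow> nat \<Rightarrow> 'a :: comm_monoid_mult"
  shows "(\<Prod>i<n. \<Prod>j<i. f j i) = (\<Prod>j<n. \<Prod>i<n. if j < i then f j i else 1)"
proof -
  have "(\<Prod>j<i. f j i) = (\<Prod>j<n. if j < i then f j i else 1)" if "i < n" for i
    using that by (intro prod.mono_neutral_cong_left) auto
  then have "(\<Prod>i<n. \<Prod>j<i. f j i) = (\<Prod>i<n. \<Prod>j<n. if j < i then f j i else 1)" by simp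
  also have "\<dots> = (\<Prod>j<n. \<Prod>i<n. if j < i then f j i else 1)" by (rule prod.swap)
  finally show ?thesis .
qed

lemma prod_if_le:
  fixes c :: "'a :: comm_monoid_mult"
  assumes "b < n"
  shows "(\<Prod>l<n. if l \<le> b then c else 1) = c ^ Suc b"
proof -
  have "(\<Prod>l<n. if l \<le> b then c else 1) = (\<Prod>l\<in>{..b}. c)"
    using assms by (intro prod.mono_neutral_cong_right) auto
  then show ?thesis by simp
qed

text \<open>Couples each Vandermonde difference with the Cauchy denominator carrying the same two
  indices. The shift can then be compared cell by cell.\<close>

definition pair_factor :: "(nat \<Rightarrow> real) \<Rightarrow> (nat \<Rightarrow> real) \<Rightarrow> nat \<Rightarrow> nat \<Rightarrow> real" where
  "pair_factor x y j l = (if j < l then x j - x l else 1) / (x j + y l)"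

text \<open>Splits off the Vandermonde product of \<open>qs\<close>, which the shift leaves
  unchanged.\<close>

lemma abs_cauchy_det_eq:
  assumes "length ps = length qs" "sorted_wrt (>) ps"
  shows "\<bar>cauchy_det ps qs\<bar> = (\<Prod>i<length ps. \<Prod>j<i. \<bar>real (qs ! j) - real (qs ! i)\<bar>) *
    (\<Prod>j<length ps. \<Prod>l<length ps. pair_factor (\<lambda>i. real (ps ! i)) (\<lambda>i. real (qs ! i) + 1) j l)"
proof -
  let ?d = "length ps"
  have "(\<Prod>i<?d. \<Prod>j<i. \<bar>real (ps ! j) - real (ps ! i)\<bar>) =
      (\<Prod>j<?d. \<Prod>i<?d. if j < i then real (ps ! j) - real (ps ! i) else 1)"
    using assms(2) by (subst prod_triangle_eq)
      (auto simp: sorted_wrt_iff_nth_less less_imp_le intro!: prod.cong)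
  moreover have "\<bar>cauchy_det ps qs\<bar> =
      (\<Prod>i<?d. \<Prod>j<i. \<bar>real (ps ! j) - real (ps ! i)\<bar> * \<bar>real (qs ! j) - real (qs ! i)\<bar>) /
      (\<Prod>i<?d. \<Prod>j<?d. real (ps ! i) + (real (qs ! j) + 1))"
    unfolding cauchy_det_eq[OF assms(1)]
    by (simp add: abs_prod abs_mult prod_nonneg add.assoc)
  ultimately show ?thesis
    by (simp add: pair_factor_def prod.distrib prod_dividef mult_ac)
qed

text \<open>Rows \<open>j > a\<close> do not change. If \<open>j, l \<le> a\<close>, the numerator
  is kept and the denominator grows by a bounded ratio. If \<open>j \<le> a < l\<close>, numerator
  and denominator both gain \<open>k\<close>, which increases a fraction below 1; hence these cells
  cost nothing and the constant does not depend on \<open>d\<close>. In the cell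
  \<open>(a, Suc a)\<close> the difference rises from at most \<open>\<delta> * k\<close> to more
  than \<open>k\<close>, which yields the factor \<open>\<delta>\<close>.\<close>

lemma prod_pair_factor_shift_le:
  fixes x y :: "nat \<Rightarrow> real"
  assumes dec: "\<And>j l. j < l \<Longrightarrow> l < d \<Longrightarrow> x l < x j"
    and x0: "\<And>j. j < d \<Longrightarrow> 0 \<le> x j" and y0: "\<And>j. j < d \<Longrightarrow> 0 < y j"
    and a: "Suc a < d" and k: "0 < k" and \<epsilon>: "0 < \<epsilon>" and \<delta>: "0 < \<delta>"
    and big: "\<And>j l. j \<le> a \<Longrightarrow> l < d \<Longrightarrow> \<epsilon> * k \<le> x j + y l"
    and close: "x a - x (Suc a) \<le> \<delta> * k"
  defines "x' \<equiv> \<lambda>l. if l \<le> a then x l + k else x l"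
  shows "(\<Prod>j<d. \<Prod>l<d. pair_factor x y j l) \<le>
    (((1 + \<epsilon>) / \<epsilon>) ^ Suc (Suc a)) ^ Suc a * \<delta> * (\<Prod>j<d. \<Prod>l<d. pair_factor x' y j l)"
proof -
  \<comment> \<open>\<open>c = 1 + 1 / \<epsilon>\<close> bounds the growth of a denominator that is
    at least \<open>\<epsilon> * k\<close> when \<open>k\<close> is added.\<close>
  define c where "c = (1 + \<epsilon>) / \<epsilon>"
  \<comment> \<open>The charged cells fill a rectangle of \<open>Suc a\<close> rows and
    \<open>Suc (Suc a)\<close> columns at price \<open>c \<ge> 1\<close> each, so the total is a
    pure power. The column \<open>Suc a\<close> is included for the close pair, which carries
    \<open>\<delta>\<close> as well.\<close>
  define e where "e j l = (if j \<le> a then if l \<le> Suc a then c else 1 else 1) *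
      (if j = a then if l = Suc a then \<delta> else 1 else 1)" for j l
  have c: "1 \<le> c" "0 < c" using \<epsilon> by (auto simp: c_def)
  have nonneg: "0 \<le> pair_factor x y j l" if "j < d" "l < d" for j l
    using that dec[of j l] x0[of j] y0[of l] by (auto simp: pair_factor_def)
  have le: "pair_factor x y j l \<le> e j l * pair_factor x' y j l" if jl: "j < d" "l < d" for j l
  proof (cases "j \<le> a")
    case False
    then show ?thesis by (auto simp: e_def x'_def pair_factor_def)
  next
    case j: True
    let ?A = "x j + y l"
    have A: "0 < ?A" "\<epsilon> * k \<le> ?A" using big[OF j jl(2)] x0[OF jl(1)] y0[OF jl(2)] by auto
    have cA: "?A + k \<le> c * ?A"
      using A \<epsilon> by (simp add: c_def field_simps)
    then have inv: "1 / ?A \<le> c / (?A + k)"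
      using A k by (simp add: field_simps)
    consider "l \<le> a" | "j = a" "l = Suc a" | "a < l" "\<not> (j = a \<and> l = Suc a)" by linarith
    then show ?thesis
    proof cases
      case 1
      define N where "N = (if j < l then x j - x l else 1)"
      have N: "0 \<le> N" using dec[of j l] jl by (auto simp: N_def)
      have "pair_factor x y j l = N * (1 / ?A)" by (simp add: pair_factor_def N_def)
      also have "\<dots> \<le> N * (c / (?A + k))" by (intro mult_left_mono inv N)
      also have "\<dots> = e j l * pair_factor x' y j l"
        using 1 j by (auto simp: e_def x'_def pair_factor_def N_def add_ac)
      finally show ?thesis .
    next
      case 2
      have d0: "0 < x a - x (Suc a)" using dec[of a "Suc a"] a by simp
      have "pair_factor x y j l = (x a - x (Suc a)) * (1 / ?A)"
        using 2 by (simp add: pair_factor_def)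
      also have "\<dots> \<le> (\<delta> * k) * (c / (?A + k))"
        using close inv A d0 \<delta> k by (intro mult_mono) auto
      \<comment> \<open>The shifted difference exceeds \<open>k\<close>, so \<open>k\<close> may be
        replaced by it.\<close>
      also have "\<dots> \<le> (\<delta> * (x a - x (Suc a) + k)) * (c / (?A + k))"
        using \<delta> d0 c A k by (intro mult_right_mono mult_left_mono) auto
      also have "\<dots> = e j l * pair_factor x' y j l"
        using 2 by (simp add: e_def x'_def pair_factor_def add_ac mult_ac diff_add_eq)
      finally show ?thesis .
    next
      case 3
      have N: "0 < x j - x l" using dec[of j l] jl 3 j by simp
      \<comment> \<open>The fraction is at most 1, so adding \<open>k\<close> above and below cannot
        decrease it.\<close>
      have "x j - x l \<le> ?A" using x0[OF jl(2)] y0[OF jl(2)] by simp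
      then have "(x j - x l) * k \<le> ?A * k" using k by (intro mult_right_mono) auto
      then have "(x j - x l) / ?A \<le> (x j - x l + k) / (?A + k)"
        using A k by (simp add: divide_simps algebra_simps)
      also have "\<dots> \<le> e j l * \<dots>"
      proof -
        have "1 \<le> e j l" using c 3 by (auto simp: e_def)
        then show ?thesis using N A k by (simp add: divide_right_mono mult_le_cancel_right1)
      qed
      also have "(x j - x l + k) / (?A + k) = pair_factor x' y j l"
        using 3 j by (simp add: pair_factor_def x'_def add_ac diff_add_eq)
      finally show ?thesis using 3 j by (simp add: pair_factor_def)
    qed
  qed
  have "(\<Prod>j<d. \<Prod>l<d. pair_factor x y j l) \<le> (\<Prod>j<d. \<Prod>l<d. e j l * pair_factor x' y j l)"
    using nonneg le by (intro prod_mono conjI prod_nonneg) auto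
  also have "\<dots> = (\<Prod>j<d. \<Prod>l<d. e j l) * (\<Prod>j<d. \<Prod>l<d. pair_factor x' y j l)"
    by (simp add: prod.distrib)
  also have "(\<Prod>j<d. \<Prod>l<d. e j l) =
      (\<Prod>j<d. (if j \<le> a then c ^ Suc (Suc a) else 1) * (if j = a then \<delta> else 1))"
  proof (rule prod.cong[OF refl])
    fix j assume "j \<in> {..<d}"
    have "(\<Prod>l<d. if j \<le> a then if l \<le> Suc a then c else 1 else 1) =
        (if j \<le> a then c ^ Suc (Suc a) else 1)"
      using prod_if_le[OF a, of c] by simp
    moreover have "(\<Prod>l<d. if j = a then if l = Suc a then \<delta> else 1 else 1) =
        (if j = a then \<delta> else 1)"
      using a by simp
    ultimately show "(\<Prod>l<d. e j l) = (if j \<le> a then c ^ Suc (Suc a) else 1) * (if j = a then \<delta> else 1)"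
      by (simp only: e_def prod.distrib)
  qed
  also have "\<dots> = (c ^ Suc (Suc a)) ^ Suc a * \<delta>"
    using a prod_if_le[of a d "c ^ Suc (Suc a)"] by (simp add: prod.distrib)
  finally show ?thesis by (simp only: c_def)
qed

lemma real_mass_nonneg:
  assumes "t > 0" "\<And>j :: int. 0 < (of_int j)\<^sup>2 + s * of_int j + t"
  shows "0 \<le> real_mass s t n c"
proof -
  have "0 < (of_int j)\<^sup>2 + (- s) * of_int j + t" for j :: int
    using assms(2)[of "- j"] by simp
  then have "0 < weight (- s) t p" for p by (rule weight_pos)
  moreover have "0 < weight s t p" for p by (rule weight_pos[OF assms(2)])
  moreover have "0 < pochhammer t n" by (rule pochhammer_pos[OF assms(1)])
  ultimately show ?thesis using assms(1)
    by (auto simp: real_mass_def less_imp_le split: prod.split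
        intro!: mult_nonneg_nonneg divide_nonneg_nonneg prod_nonneg)
qed

text \<open>Product of the losses of the prefactor, of the \<open>ps\<close> weights and of the
  squared determinant. It involves neither \<open>n\<close>, nor \<open>\<delta>\<close>, nor the
  number of coordinates.\<close>

definition shift_const :: "real \<Rightarrow> real \<Rightarrow> real \<Rightarrow> nat \<Rightarrow> real" where
  "shift_const s t \<epsilon> a = exp (\<bar>t - 1\<bar>) ^ Suc a * exp (2 * \<bar>s\<bar> / \<epsilon>) ^ Suc a *
     ((((1 + \<epsilon>) / \<epsilon>) ^ Suc (Suc a)) ^ Suc a)\<^sup>2"

text \<open>The shift by \<open>n\<close> is comparable to the raised coordinates, which are of
  order at least \<open>\<epsilon> * n\<close>, so each part of the mass loses only a bounded
  factor. The power of \<open>t\<close> and the \<open>qs\<close> weights are the same on both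
  sides; \<open>\<delta>\<close> is squared along with the determinant.\<close>

lemma real_mass_le_shift:
  assumes t: "t > 0" and pos: "\<And>j :: int. 0 < (of_int j)\<^sup>2 + s * of_int j + t"
    and c: "(ps, qs) \<in> configs n" and a: "Suc a < length ps"
    and \<epsilon>: "\<epsilon> > 0" and \<delta>: "\<delta> > 0" and n: "0 < n" "2 * \<bar>s\<bar> + 1 \<le> \<epsilon> * real n"
    and big: "\<epsilon> * real n < real (ps ! a) + 1 / 2"
    and close: "real (ps ! a) - real (ps ! Suc a) \<le> \<delta> * real n"
  shows "real_mass s t n (ps, qs) \<le>
    shift_const s t \<epsilon> a * \<delta>\<^sup>2 * real_mass s t (n + Suc a * n) (shift_list a n ps, qs)"
proof -
  let ?d = "length ps" and ?ps = "shift_list a n ps" and ?n = "n + Suc a * n"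
  let ?C = "(((1 + \<epsilon>) / \<epsilon>) ^ Suc (Suc a)) ^ Suc a"
  have len: "length ps = length qs" and sorted: "sorted_wrt (>) ps" using c by (auto simp: configs_def)
  have dec: "ps ! l < ps ! j" if "j < l" "l < ?d" for j l
    using that sorted by (auto simp: sorted_wrt_iff_nth_less)
  have big': "\<epsilon> * real n < real (ps ! j) + 1 / 2" if "j \<le> a" for j
  proof -
    have "ps ! a \<le> ps ! j" using that dec[of j a] a by (cases "j = a") (auto simp: less_imp_le)
    with big show ?thesis by linarith
  qed
  have wpos: "0 < weight s t p" for p by (rule weight_pos[OF pos])
  have wpos': "0 < weight (- s) t p" for p
    using pos[of "- _"] by (intro weight_pos) simp
  have factorial: "fact n / pochhammer t n \<le> exp (\<bar>t - 1\<bar>) ^ Suc a * (fact ?n / pochhammer t ?n)"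
  proof -
    \<comment> \<open>Each block of \<open>n\<close> steps costs at most
      \<open>exp \<bar>t - 1\<bar>\<close>, and there are \<open>Suc a\<close> blocks.\<close>
    let ?e = "exp (\<bar>t - 1\<bar> / (real n + 1))"
    have "real n * (\<bar>t - 1\<bar> / (real n + 1)) \<le> \<bar>t - 1\<bar>" by (simp add: field_simps)
    then have "?e ^ n \<le> exp \<bar>t - 1\<bar>" by (simp add: exp_of_nat_mult[symmetric])
    then have "(?e ^ n) ^ Suc a \<le> exp \<bar>t - 1\<bar> ^ Suc a" by (intro power_mono) auto
    moreover have "?e ^ (Suc a * n) = (?e ^ n) ^ Suc a" by (metis mult.commute power_mult)
    ultimately have "?e ^ (Suc a * n) \<le> exp \<bar>t - 1\<bar> ^ Suc a" by simp
    then have "?e ^ (Suc a * n) * (fact ?n / pochhammer t ?n) \<le>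
        exp \<bar>t - 1\<bar> ^ Suc a * (fact ?n / pochhammer t ?n)"
      using pochhammer_pos[OF t, of ?n] by (intro mult_right_mono) auto
    with fact_div_pochhammer_le[OF t, of n "Suc a * n"] show ?thesis by linarith
  qed
  have weights: "(\<Prod>i<?d. weight s t (ps ! i)) \<le>
      exp (2 * \<bar>s\<bar> / \<epsilon>) ^ Suc a * (\<Prod>i<?d. weight s t (?ps ! i))"
  proof -
    have "weight s t (ps ! i) \<le> (if i \<le> a then exp (2 * \<bar>s\<bar> / \<epsilon>) else 1) * weight s t (?ps ! i)"
      if "i < ?d" for i
    proof (cases "i \<le> a")
      case True
      let ?p = "ps ! i"
      have p: "\<epsilon> * real n < real ?p + 1/2" by (rule big'[OF True])
      \<comment> \<open>The lower bound on \<open>\<epsilon> * n\<close> absorbs the 1/2 and yields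
        \<open>2 * \<bar>s\<bar> \<le> ?p\<close>.\<close>
      have "weight s t ?p \<le> exp (2 * \<bar>s\<bar> / (real ?p + 1)) ^ n * weight s t (?p + n)"
        using p n by (intro weight_le_weight_add pos t) auto
      also have "exp (2 * \<bar>s\<bar> / (real ?p + 1)) ^ n \<le> exp (2 * \<bar>s\<bar> / \<epsilon>)"
      proof -
        have "real n / (real ?p + 1) \<le> 1 / \<epsilon>"
          using p \<epsilon> by (simp add: field_simps)
        then have "2 * \<bar>s\<bar> * (real n / (real ?p + 1)) \<le> 2 * \<bar>s\<bar> * (1 / \<epsilon>)"
          by (intro mult_left_mono) auto
        then show ?thesis by (simp add: exp_of_nat_mult[symmetric] mult_ac)
      qed
      finally show ?thesis using True that wpos by (simp add: nth_shift_list mult_right_mono less_imp_le)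
    qed (use that in \<open>simp add: nth_shift_list\<close>)
    then have "(\<Prod>i<?d. weight s t (ps ! i)) \<le>
        (\<Prod>i<?d. (if i \<le> a then exp (2 * \<bar>s\<bar> / \<epsilon>) else 1) * weight s t (?ps ! i))"
      using wpos by (intro prod_mono) (auto simp: less_imp_le)
    then show ?thesis using a prod_if_le[of a ?d "exp (2 * \<bar>s\<bar> / \<epsilon>)"] by (simp only: prod.distrib)
  qed
  have det: "(cauchy_det ps qs)\<^sup>2 \<le> (?C * \<delta> * \<bar>cauchy_det ?ps qs\<bar>)\<^sup>2"
  proof -
    let ?x = "\<lambda>i. real (ps ! i)" and ?y = "\<lambda>i. real (qs ! i) + 1"
    let ?x' = "\<lambda>l. if l \<le> a then ?x l + real n else ?x l"
    let ?Q = "\<Prod>i<?d. \<Prod>j<i. \<bar>real (qs ! j) - real (qs ! i)\<bar>"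
    have "(\<Prod>j<?d. \<Prod>l<?d. pair_factor ?x ?y j l) \<le> ?C * \<delta> * (\<Prod>j<?d. \<Prod>l<?d. pair_factor ?x' ?y j l)"
      using dec a \<epsilon> \<delta> n close
    proof (intro prod_pair_factor_shift_le)
      fix j l assume "j \<le> a"
      \<comment> \<open>The offset 1 in \<open>?y\<close> covers the 1/2 in the lower bound.\<close>
      from big'[OF this] show "\<epsilon> * real n \<le> ?x j + ?y l" by simp
    qed auto
    then have "?Q * (\<Prod>j<?d. \<Prod>l<?d. pair_factor ?x ?y j l) \<le>
        ?Q * (?C * \<delta> * (\<Prod>j<?d. \<Prod>l<?d. pair_factor ?x' ?y j l))"
      by (intro mult_left_mono prod_nonneg ballI) auto
    moreover have "(\<Prod>j<?d. \<Prod>l<?d. pair_factor ?x' ?y j l) =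
        (\<Prod>j<?d. \<Prod>l<?d. pair_factor (\<lambda>i. real (?ps ! i)) ?y j l)"
      by (intro prod.cong refl) (simp add: pair_factor_def nth_shift_list)
    moreover have "sorted_wrt (>) ?ps"
      using shift_list_in_configs[OF c, of a n] a by (simp add: configs_def)
    ultimately have "\<bar>cauchy_det ps qs\<bar> \<le> ?C * \<delta> * \<bar>cauchy_det ?ps qs\<bar>"
      using len sorted by (simp add: abs_cauchy_det_eq mult_ac)
    then show ?thesis using power_mono[of "\<bar>cauchy_det ps qs\<bar>" _ 2] by simp
  qed
  let ?F = "fact ?n / pochhammer t ?n" and ?W = "\<Prod>i<?d. weight s t (?ps ! i)"
    and ?W' = "\<Prod>i<?d. weight (- s) t (qs ! i)"
  have "real_mass s t n (ps, qs) \<le> (exp (\<bar>t - 1\<bar>) ^ Suc a * ?F) * t ^ ?d *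
      (exp (2 * \<bar>s\<bar> / \<epsilon>) ^ Suc a * ?W) * ?W' * (?C * \<delta> * \<bar>cauchy_det ?ps qs\<bar>)\<^sup>2"
    unfolding real_mass_def prod.case using factorial weights det t wpos wpos' pochhammer_pos[OF t]
    by (intro mult_mono mult_nonneg_nonneg prod_nonneg order_refl)
      (auto simp: less_imp_le intro!: mult_nonneg_nonneg prod_nonneg)
  also have "\<dots> = shift_const s t \<epsilon> a * \<delta>\<^sup>2 * real_mass s t ?n (?ps, qs)"
    unfolding shift_const_def real_mass_def prod.case length_shift_list
    by (simp only: power_mult_distrib power2_abs mult_ac)
  finally show ?thesis .
qed

section \<open>Passage to the weak limit\<close>

text \<open>Every configuration with a nonzero term satisfies the closeness and size conditions of
  the mass comparison. Injectivity of the shift turns the sum of shifted masses into a partial sum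
  at the larger size, and nonnegativity bounds that by the total.\<close>

lemma sum_config_mass_close_le:
  assumes st: "z + z' = of_real s" "z * z' = of_real t"
    and t: "t > 0" and pos: "\<And>j :: int. 0 < (of_int j)\<^sup>2 + s * of_int j + t"
    and \<delta>: "0 < \<delta>" "\<delta> \<le> \<epsilon>" and n: "0 < n" "2 * \<bar>s\<bar> + 1 \<le> \<epsilon> * real n"
    and g: "\<And>\<omega>. 0 \<le> g \<omega>" "\<And>\<omega>. g \<omega> \<le> 1"
    and supp: "\<And>\<omega>. g \<omega> \<noteq> 0 \<Longrightarrow> \<bar>fst \<omega> a - fst \<omega> (Suc a)\<bar> < \<delta> \<and> \<epsilon> < fst \<omega> a"
  shows "(\<Sum>c\<in>configs n. config_mass z z' n c * g (config_point n c)) \<le>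
    shift_const s t \<epsilon> a * \<delta>\<^sup>2 *
      (\<Sum>c\<in>configs (n + Suc a * n). config_mass z z' (n + Suc a * n) c)"
proof -
  let ?n = "n + Suc a * n" and ?K = "shift_const s t \<epsilon> a * \<delta>\<^sup>2"
  let ?B = "{c \<in> configs n. g (config_point n c) \<noteq> 0}"
  define h where "h = (\<lambda>(ps, qs :: nat list). (shift_list a n ps, qs))"
  have mass: "config_mass z z' m c = real_mass s t m c" for m c
    by (rule config_mass_eq_real_mass[OF st])
  have nonneg: "0 \<le> real_mass s t m c" for m c
    by (rule real_mass_nonneg[OF t pos])
  have K: "0 \<le> ?K" using \<delta> by (simp add: shift_const_def)
  have B: "Suc a < length ps \<and> \<epsilon> * real n < real (ps ! a) + 1 / 2 \<and>
      real (ps ! a) - real (ps ! Suc a) \<le> \<delta> * real n"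
    if "(ps, qs) \<in> configs n" "g (config_point n (ps, qs)) \<noteq> 0" for ps qs
  proof -
    let ?\<alpha> = "fst (config_point n (ps, qs))"
    have \<alpha>: "?\<alpha> i = (if i < length ps then (real (ps ! i) + 1/2) / real n else 0)" for i
      by (simp add: config_point_def)
    have *: "\<bar>?\<alpha> a - ?\<alpha> (Suc a)\<bar> < \<delta>" "\<epsilon> < ?\<alpha> a" using supp[OF that(2)] by auto
    \<comment> \<open>An absent coordinate has the default value 0; the gap would then be the
      coordinate \<open>a\<close> itself, which exceeds
      \<open>\<epsilon> \<ge> \<delta>\<close>.\<close>
    have a: "Suc a < length ps"
    proof (rule ccontr)
      assume "\<not> Suc a < length ps"
      then have "?\<alpha> (Suc a) = 0" by (simp add: \<alpha>)
      with * \<delta> show False by auto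
    qed
    have "?\<alpha> a - ?\<alpha> (Suc a) = (real (ps ! a) - real (ps ! Suc a)) / real n"
      using a by (simp add: \<alpha> diff_divide_distrib add_divide_distrib)
    moreover have "?\<alpha> a - ?\<alpha> (Suc a) < \<delta>" using *(1) by linarith
    ultimately have "(real (ps ! a) - real (ps ! Suc a)) / real n < \<delta>" by simp
    then show ?thesis using a *(2) n by (simp add: \<alpha> field_simps)
  qed
  have "(\<Sum>c\<in>configs n. config_mass z z' n c * g (config_point n c)) =
      (\<Sum>c\<in>?B. real_mass s t n c * g (config_point n c))"
    unfolding mass by (intro sum.mono_neutral_right finite_configs) auto
  also have "\<dots> \<le> (\<Sum>c\<in>?B. ?K * real_mass s t ?n (h c))"
  proof (rule sum_mono)
    fix c assume c: "c \<in> ?B"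
    obtain ps qs where [simp]: "c = (ps, qs)" by fastforce
    have "real_mass s t n c * g (config_point n c) \<le> real_mass s t n c * 1"
      by (intro mult_left_mono g nonneg)
    also have "\<dots> \<le> ?K * real_mass s t ?n (h c)"
      using c B[of ps qs] \<delta> n real_mass_le_shift[OF t pos, of ps qs n a \<epsilon> \<delta>] by (simp add: h_def)
    finally show "real_mass s t n c * g (config_point n c) \<le> ?K * real_mass s t ?n (h c)" .
  qed
  also have "\<dots> = ?K * (\<Sum>c\<in>h ` ?B. real_mass s t ?n c)"
  proof -
    have "inj_on h ?B" by (auto simp: inj_on_def h_def inj_eq[OF inj_shift_list])
    then show ?thesis by (simp add: sum.reindex sum_distrib_left)
  qed
  also have "\<dots> \<le> ?K * (\<Sum>c\<in>configs ?n. real_mass s t ?n c)"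
  proof (intro mult_left_mono K sum_mono2 finite_configs nonneg)
    show "h ` ?B \<subseteq> configs ?n"
    proof
      fix c' assume "c' \<in> h ` ?B"
      then obtain ps qs where "c' = (shift_list a n ps, qs)" "(ps, qs) \<in> configs n"
        "g (config_point n (ps, qs)) \<noteq> 0" by (auto simp: h_def)
      with B[of ps qs] shift_list_in_configs[of ps qs n a n] show "c' \<in> configs ?n" by simp
    qed
  qed
  finally show ?thesis unfolding mass .
qed

lemma continuous_fst_coordinate [continuous_intros]:
  "continuous_on UNIV (\<lambda>\<omega> :: thoma_pt. fst \<omega> i)"
  using continuous_on_compose2[OF continuous_on_product_coordinates[of i] continuous_on_fst[OF continuous_on_id]]
  by simp

text \<open>The indicator of the event is dominated by a continuous bump to which the uniform bound
  applies for all large \<open>n\<close>. The gap between \<open>2 * \<epsilon>\<close> and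
  \<open>\<epsilon>\<close> leaves room for the bump to rise.\<close>

lemma prob_coordinates_equal_le:
  assumes adm: "admissible z z'"
    and P: "prob_space P" "sets P = sets borel" "is_weak_limit_Pn z z' P"
    and \<epsilon>: "\<epsilon> > 0"
  obtains K where "\<And>\<delta>. 0 < \<delta> \<Longrightarrow> \<delta> \<le> \<epsilon> \<Longrightarrow>
    measure P {\<omega>. fst \<omega> a = fst \<omega> (Suc a) \<and> 2 * \<epsilon> \<le> fst \<omega> a} \<le> K * \<delta>\<^sup>2"
proof -
  interpret prob_space P by fact
  obtain s t where st: "z + z' = of_real s" "z * z' = of_real t" "t > 0"
    "\<And>j :: int. 0 < (of_int j)\<^sup>2 + s * of_int j + t"
    using admissible_real[OF adm] by blast
  let ?E = "{\<omega> :: thoma_pt. fst \<omega> a = fst \<omega> (Suc a) \<and> 2 * \<epsilon> \<le> fst \<omega> a}"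
  have conv: "(\<lambda>n. \<Sum>c\<in>configs n. config_mass z z' n c * f (config_point n c)) \<longlonglongrightarrow> integral\<^sup>L P f"
    if "continuous_on UNIV f" "bounded (range f)" for f
    using P(3) that by (auto simp: is_weak_limit_Pn_def)
  have "closed ?E"
    by (intro closed_Collect_conj closed_Collect_eq closed_Collect_le continuous_intros)
  then have E: "?E \<in> sets P" using P(2) by simp
  have "measure P ?E \<le> shift_const s t \<epsilon> a * \<delta>\<^sup>2" if \<delta>: "0 < \<delta>" "\<delta> \<le> \<epsilon>" for \<delta>
  proof -
    \<comment> \<open>A tent of half-width \<open>\<delta>\<close> in the difference, times a ramp
      rising from 0 at \<open>\<epsilon>\<close> to 1 at \<open>2 * \<epsilon>\<close>.\<close>
    define g :: "thoma_pt \<Rightarrow> real" where "g \<omega> = max 0 (1 - \<bar>fst \<omega> a - fst \<omega> (Suc a)\<bar> / \<delta>) *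
      max 0 (min 1 (fst \<omega> a / \<epsilon> - 1))" for \<omega>
    have g0: "0 \<le> g \<omega>" for \<omega> by (simp add: g_def)
    have g1: "g \<omega> \<le> 1" for \<omega> using \<delta> by (auto simp: g_def intro!: mult_le_one)
    have supp: "\<bar>fst \<omega> a - fst \<omega> (Suc a)\<bar> < \<delta> \<and> \<epsilon> < fst \<omega> a" if "g \<omega> \<noteq> 0" for \<omega>
    proof -
      have "0 < 1 - \<bar>fst \<omega> a - fst \<omega> (Suc a)\<bar> / \<delta>" "0 < fst \<omega> a / \<epsilon> - 1"
      proof -
        have "max 0 (1 - \<bar>fst \<omega> a - fst \<omega> (Suc a)\<bar> / \<delta>) \<noteq> 0"
          "max 0 (min 1 (fst \<omega> a / \<epsilon> - 1)) \<noteq> 0"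
          using that unfolding g_def by auto
        then show "0 < 1 - \<bar>fst \<omega> a - fst \<omega> (Suc a)\<bar> / \<delta>" "0 < fst \<omega> a / \<epsilon> - 1"
          by linarith+
      qed
      then show ?thesis using \<delta> \<epsilon> by (simp add: field_simps)
    qed
    have cont: "continuous_on UNIV g"
      unfolding g_def using \<delta> \<epsilon> by (intro continuous_intros) auto
    have bdd: "bounded (range g)"
      using g0 g1 by (intro boundedI[of _ 1]) auto
    have meas: "g \<in> borel_measurable P"
      using borel_measurable_continuous_onI[OF cont] measurable_cong_sets[OF P(2) refl, of borel] by blast
    have "measure P ?E = (\<integral>\<omega>. indicator ?E \<omega> \<partial>P)"
      using E by simp
    also have "\<dots> \<le> integral\<^sup>L P g"
    proof (rule integral_mono)
      show "integrable P (indicator ?E :: thoma_pt \<Rightarrow> real)"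
        using E by (simp add: integrable_indicator_iff emeasure_eq_measure)
      show "integrable P g"
        using g0 g1 by (intro integrable_const_bound[of _ 1] meas) auto
      have "g \<omega> = 1" if "\<omega> \<in> ?E" for \<omega>
        using that \<epsilon> by (auto simp: g_def field_simps max_def min_def)
      then show "indicator ?E \<omega> \<le> g \<omega>" for \<omega>
        using g0 by (auto simp: indicator_def)
    qed
    also have "\<dots> \<le> shift_const s t \<epsilon> a * \<delta>\<^sup>2"
    proof (rule LIMSEQ_le[OF conv[OF cont bdd]])
      \<comment> \<open>Weak convergence tested on the constant 1 supplies the asymptotic
        normalisation, which is then used along the subsequence of shifted sizes.\<close>
      have "(\<lambda>n. \<Sum>c\<in>configs n. config_mass z z' n c) \<longlonglongrightarrow> 1"
        using conv[of "\<lambda>_. 1"] by (simp add: prob_space)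
      moreover have "strict_mono (\<lambda>n. n + Suc a * n)"
        by (intro strict_monoI add_less_le_mono mult_le_mono) auto
      ultimately have "((\<lambda>n. \<Sum>c\<in>configs n. config_mass z z' n c) \<circ> (\<lambda>n. n + Suc a * n)) \<longlonglongrightarrow> 1"
        by (rule LIMSEQ_subseq_LIMSEQ)
      then have "(\<lambda>n. shift_const s t \<epsilon> a * \<delta>\<^sup>2 *
          ((\<lambda>n. \<Sum>c\<in>configs n. config_mass z z' n c) \<circ> (\<lambda>n. n + Suc a * n)) n)
          \<longlonglongrightarrow> shift_const s t \<epsilon> a * \<delta>\<^sup>2 * 1"
        by (rule tendsto_mult_left)
      then show "(\<lambda>n. shift_const s t \<epsilon> a * \<delta>\<^sup>2 *
          (\<Sum>c\<in>configs (n + Suc a * n). config_mass z z' (n + Suc a * n) c))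
          \<longlonglongrightarrow> shift_const s t \<epsilon> a * \<delta>\<^sup>2"
        by (simp add: o_def)
      obtain N where N: "(2 * \<bar>s\<bar> + 1) / \<epsilon> < real N" using reals_Archimedean2 by blast
      show "\<exists>N. \<forall>n\<ge>N. (\<Sum>c\<in>configs n. config_mass z z' n c * g (config_point n c)) \<le>
        shift_const s t \<epsilon> a * \<delta>\<^sup>2 *
          (\<Sum>c\<in>configs (n + Suc a * n). config_mass z z' (n + Suc a * n) c)"
      proof (intro exI[of _ "Suc N"] allI impI)
        fix n assume n: "Suc N \<le> n"
        then have "real N \<le> real n" by simp
        with N have "(2 * \<bar>s\<bar> + 1) / \<epsilon> \<le> real n" by linarith
        then have "2 * \<bar>s\<bar> + 1 \<le> \<epsilon> * real n" using \<epsilon> by (simp add: field_simps)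
        with n show "(\<Sum>c\<in>configs n. config_mass z z' n c * g (config_point n c)) \<le>
            shift_const s t \<epsilon> a * \<delta>\<^sup>2 *
              (\<Sum>c\<in>configs (n + Suc a * n). config_mass z z' (n + Suc a * n) c)"
          by (intro sum_config_mass_close_le st \<delta> g0 g1 supp) auto
      qed
    qed
    finally show ?thesis .
  qed
  then show ?thesis using that by blast
qed

text \<open>For a fixed threshold, \<open>\<delta>\<close> tending to 0 makes the coincidence event
  null. Countably many indices and thresholds \<open>2 / (m + 1)\<close> exhaust all coincidences at
  positive values.\<close>

lemma AE_fst_coordinates_distinct:
  assumes adm: "admissible z z'"
    and P: "prob_space P" "sets P = sets borel" "is_weak_limit_Pn z z' P"
  shows "AE \<omega> in P. \<forall>a. fst \<omega> a = fst \<omega> (Suc a) \<longrightarrow> fst \<omega> a \<le> 0"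
proof -
  interpret prob_space P by fact
  have "AE \<omega> in P. \<not> (fst \<omega> a = fst \<omega> (Suc a) \<and> 2 * inverse (real (Suc m)) \<le> fst \<omega> a)" for a m
  proof -
    define \<epsilon> where "\<epsilon> = inverse (real (Suc m))"
    have \<epsilon>: "\<epsilon> > 0" by (simp add: \<epsilon>_def)
    let ?E = "{\<omega> :: thoma_pt. fst \<omega> a = fst \<omega> (Suc a) \<and> 2 * \<epsilon> \<le> fst \<omega> a}"
    obtain K where K: "\<And>\<delta>. 0 < \<delta> \<Longrightarrow> \<delta> \<le> \<epsilon> \<Longrightarrow> measure P ?E \<le> K * \<delta>\<^sup>2"
      using prob_coordinates_equal_le[OF adm P \<epsilon>] by blast
    \<comment> \<open>The choice \<open>\<delta> = \<epsilon> / (n + 1)\<close> tends to 0 and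
      respects \<open>\<delta> \<le> \<epsilon>\<close>.\<close>
    have "(\<lambda>n. K * (\<epsilon> * inverse (real (Suc n)))\<^sup>2) \<longlonglongrightarrow> K * (\<epsilon> * 0)\<^sup>2"
      by (intro tendsto_intros LIMSEQ_inverse_real_of_nat)
    moreover have "measure P ?E \<le> K * (\<epsilon> * inverse (real (Suc n)))\<^sup>2" for n
      using \<epsilon> by (intro K) (auto simp: field_simps)
    ultimately have "measure P ?E \<le> 0"
      using LIMSEQ_le_const[of "\<lambda>n. K * (\<epsilon> * inverse (real (Suc n)))\<^sup>2" 0] by simp
    then have "emeasure P ?E = 0" by (simp add: emeasure_eq_measure measure_le_0_iff)
    moreover have "closed ?E"
      by (intro closed_Collect_conj closed_Collect_eq closed_Collect_le continuous_intros)
    ultimately have "?E \<in> null_sets P" using P(2) by (simp add: null_sets_def)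
    then have "AE \<omega> in P. \<omega> \<notin> ?E" by (rule AE_not_in)
    then show ?thesis by (simp add: \<epsilon>_def)
  qed
  then have "AE \<omega> in P. \<forall>a m. \<not> (fst \<omega> a = fst \<omega> (Suc a) \<and> 2 * inverse (real (Suc m)) \<le> fst \<omega> a)"
    by (simp only: AE_all_countable) blast
  then show ?thesis
  proof (eventually_elim, intro allI impI)
    fix \<omega> :: thoma_pt and a
    assume *: "\<forall>a m. \<not> (fst \<omega> a = fst \<omega> (Suc a) \<and> 2 * inverse (real (Suc m)) \<le> fst \<omega> a)"
      and eq: "fst \<omega> a = fst \<omega> (Suc a)"
    show "fst \<omega> a \<le> 0"
    proof (rule ccontr)
      assume "\<not> fst \<omega> a \<le> 0"
      then obtain m where "inverse (real (Suc m)) < fst \<omega> a / 2"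
        using reals_Archimedean[of "fst \<omega> a / 2"] by auto
      then have "2 * inverse (real (Suc m)) \<le> fst \<omega> a" by simp
      with * eq show False by blast
    qed
  qed
qed

section \<open>Symmetry exchanging the two coordinate sequences\<close>

text \<open>The product formula is symmetric in the two lists once the factors of the denominator
  are reordered.\<close>

lemma cauchy_det_commute:
  assumes "length ps = length qs"
  shows "cauchy_det qs ps = cauchy_det ps qs"
proof -
  have "(\<Prod>i<length ps. \<Prod>j<length ps. real (qs ! i) + real (ps ! j) + 1) =
      (\<Prod>i<length ps. \<Prod>j<length ps. real (ps ! i) + real (qs ! j) + 1)"
    by (subst prod.swap) (simp add: add_ac)
  then show ?thesis
    using assms by (simp add: cauchy_det_eq mult.commute)
qed

text \<open>Negating both parameters keeps \<open>z * z'\<close> and interchanges the weights of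
  \<open>ps\<close> and \<open>qs\<close>, so swapping the lists preserves the mass. Since the swap
  is continuous, \<open>f \<circ> prod.swap\<close> is an allowed test function for the original
  limit.\<close>

lemma is_weak_limit_Pn_swap:
  assumes P: "sets P = sets borel" "is_weak_limit_Pn z z' P"
  shows "is_weak_limit_Pn (- z) (- z') (distr P borel prod.swap)"
  unfolding is_weak_limit_Pn_def
proof (intro allI impI, elim conjE)
  fix f :: "thoma_pt \<Rightarrow> real"
  assume f: "continuous_on UNIV f" "bounded (range f)"
  have cont: "continuous_on UNIV (prod.swap :: thoma_pt \<Rightarrow> thoma_pt)"
    by (rule continuous_on_swap)
  have swap: "(prod.swap :: thoma_pt \<Rightarrow> thoma_pt) \<in> measurable P borel"
    using borel_measurable_continuous_onI[OF cont] measurable_cong_sets[OF P(1) refl] by blast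
  have "continuous_on UNIV (f \<circ> prod.swap)"
    using f(1) cont by (intro continuous_on_compose) (auto intro: continuous_on_subset)
  moreover have "bounded (range (f \<circ> prod.swap))"
    using f(2) by (rule bounded_subset) auto
  ultimately have "(\<lambda>n. \<Sum>c\<in>configs n. config_mass z z' n c * (f \<circ> prod.swap) (config_point n c))
      \<longlonglongrightarrow> integral\<^sup>L P (f \<circ> prod.swap)"
    using P(2) unfolding is_weak_limit_Pn_def by blast
  moreover have "integral\<^sup>L P (f \<circ> prod.swap) = integral\<^sup>L (distr P borel prod.swap) f"
    using swap borel_measurable_continuous_onI[OF f(1)] by (simp add: integral_distr o_def)
  moreover have "(\<Sum>c\<in>configs n. config_mass z z' n c * (f \<circ> prod.swap) (config_point n c)) =
      (\<Sum>c\<in>configs n. config_mass (- z) (- z') n c * f (config_point n c))" for n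
  proof (rule sum.reindex_bij_witness[of _ prod.swap prod.swap])
    fix c assume c: "c \<in> configs n"
    obtain ps qs where [simp]: "c = (ps, qs)" by fastforce
    have len: "length ps = length qs" using c by (simp add: configs_def)
    have "config_mass (- z) (- z') n (qs, ps) = config_mass z z' n (ps, qs)"
      using len by (simp add: config_mass_def Let_def cauchy_det_commute mult_ac)
    then show "config_mass (- z) (- z') n (prod.swap c) * f (config_point n (prod.swap c)) =
        config_mass z z' n c * (f \<circ> prod.swap) (config_point n c)"
      by (simp add: config_point_def)
  qed (auto simp: configs_def)
  ultimately show "(\<lambda>n. \<Sum>c\<in>configs n. config_mass (- z) (- z') n c * f (config_point n c))
      \<longlonglongrightarrow> integral\<^sup>L (distr P borel prod.swap) f"
    by simp
qed

lemma AE_snd_coordinates_distinct: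
  assumes adm: "admissible z z'"
    and P: "prob_space P" "sets P = sets borel" "is_weak_limit_Pn z z' P"
  shows "AE \<omega> in P. \<forall>a. snd \<omega> a = snd \<omega> (Suc a) \<longrightarrow> snd \<omega> a \<le> 0"
proof -
  have "continuous_on UNIV (prod.swap :: thoma_pt \<Rightarrow> thoma_pt)"
    by (rule continuous_on_swap)
  then have swap: "(prod.swap :: thoma_pt \<Rightarrow> thoma_pt) \<in> measurable P borel"
    using borel_measurable_continuous_onI measurable_cong_sets[OF P(2) refl] by blast
  have "AE \<omega> in distr P borel prod.swap. \<forall>a. fst \<omega> a = fst \<omega> (Suc a) \<longrightarrow> fst \<omega> a \<le> (0 :: real)"
    using prob_space.prob_space_distr[OF P(1) swap] is_weak_limit_Pn_swap[OF P(2,3)]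
    by (intro AE_fst_coordinates_distinct[OF admissible_uminus[OF adm]]) auto
  from AE_distrD[OF swap this] show ?thesis by simp
qed

section \<open>From distinct neighbours to a simple point configuration\<close>

text \<open>A decreasing sequence with equal values at two indices is constant between them, so two
  neighbours already coincide.\<close>

lemma antimono_neq_if_Suc_distinct:
  fixes f :: "nat \<Rightarrow> real"
  assumes "antimono f" "\<And>i. f i = f (Suc i) \<Longrightarrow> f i \<le> 0" "0 < f i" "i \<noteq> j"
  shows "f i \<noteq> f j"
proof
  assume eq: "f i = f j"
  define k l where "k = min i j" and "l = max i j"
  have kl: "Suc k \<le> l" "f k = f l" "0 < f k"
    using assms(3,4) eq by (auto simp: k_def l_def min_def max_def)
  have "f l \<le> f (Suc k)" "f (Suc k) \<le> f k"
    using antimonoD[OF assms(1)] kl(1) by auto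
  with kl assms(2)[of k] show False by auto
qed

text \<open>Indexed \<alpha> points are positive and indexed \<beta> points negative, so a
  coincidence can only occur within one of the two sequences.\<close>

lemma pp_simpleI:
  assumes "\<omega> \<in> thoma_simplex"
    and "\<And>a. fst \<omega> a = fst \<omega> (Suc a) \<Longrightarrow> fst \<omega> a \<le> 0"
    and "\<And>a. snd \<omega> a = snd \<omega> (Suc a) \<Longrightarrow> snd \<omega> a \<le> 0"
  shows "pp_simple \<omega>"
  unfolding pp_simple_def
proof (intro ballI impI)
  have anti: "antimono (fst \<omega>)" "antimono (snd \<omega>)" and nonneg: "\<And>i. 0 \<le> fst \<omega> i" "\<And>i. 0 \<le> snd \<omega> i"
    using assms(1) by (auto simp: thoma_simplex_def)
  fix k l assume kl: "k \<in> pp_index \<omega>" "l \<in> pp_index \<omega>" "k \<noteq> l"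
  have pos: "0 < fst \<omega> i" if "Inl i \<in> pp_index \<omega>" for i
    using that nonneg(1)[of i] by (auto simp: pp_index_def)
  have pos': "0 < snd \<omega> i" if "Inr i \<in> pp_index \<omega>" for i
    using that nonneg(2)[of i] by (auto simp: pp_index_def)
  show "pp_point \<omega> k \<noteq> pp_point \<omega> l"
  proof (cases k; cases l)
    fix i j assume "k = Inl i" "l = Inl j"
    then show ?thesis
      using antimono_neq_if_Suc_distinct[OF anti(1) assms(2), of i j] pos kl
      by (auto simp: pp_point_def)
  next
    fix i j assume "k = Inr i" "l = Inr j"
    then show ?thesis
      using antimono_neq_if_Suc_distinct[OF anti(2) assms(3), of i j] pos' kl
      by (auto simp: pp_point_def)
  next
    fix i j assume "k = Inl i" "l = Inr j"
    then show ?thesis using pos[of i] pos'[of j] kl by (auto simp: pp_point_def)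
  next
    fix i j assume "k = Inr i" "l = Inl j"
    then show ?thesis using pos[of j] pos'[of i] kl by (auto simp: pp_point_def)
  qed
qed

lemma map_pp_point_notin_diagonal_set:
  assumes "pp_simple \<omega>" "distinct ks" "set ks \<subseteq> pp_index \<omega>" "length ks = n"
  shows "map (pp_point \<omega>) ks \<notin> diagonal_set n"
proof
  assume "map (pp_point \<omega>) ks \<in> diagonal_set n"
  then obtain i j where ij: "i < j" "j < n" "pp_point \<omega> (ks ! i) = pp_point \<omega> (ks ! j)"
    using assms(4) by (auto simp: diagonal_set_def)
  then have "ks ! i \<noteq> ks ! j" using assms(2,4) by (simp add: nth_eq_iff_index_eq)
  moreover have "ks ! i \<in> pp_index \<omega>" "ks ! j \<in> pp_index \<omega>" using assms(3,4) ij by auto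
  ultimately show False using assms(1) ij by (auto simp: pp_simple_def)
qed

theorem theorem2p5p1:
  fixes z z' :: complex and P :: "thoma_pt measure"
  assumes "admissible z z'"
    and "prob_space P" and "sets P = sets borel"
    and "emeasure P thoma_simplex = 1"
    and "is_weak_limit_Pn z z' P"
  shows "(AE \<omega> in P. pp_simple \<omega>) \<and>
         (\<forall>n\<ge>2. correlation_measure P n (diagonal_set n) = 0)"
proof (intro conjI allI impI)
  interpret prob_space P by fact
  have "AE \<omega> in P. \<omega> \<in> thoma_simplex"
    using assms(4) by (intro AE_prob_1) (simp add: measure_def)
  with AE_fst_coordinates_distinct[OF assms(1-3,5)] AE_snd_coordinates_distinct[OF assms(1-3,5)]
  show simple: "AE \<omega> in P. pp_simple \<omega>"
    by eventually_elim (rule pp_simpleI, auto)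
  fix n :: nat
  \<comment> \<open>For a simple configuration no tuple of distinct indices lands on the diagonal,
    so the integrand is almost surely the count of an empty set.\<close>
  have "correlation_measure P n (diagonal_set n) = (\<integral>\<^sup>+ \<omega>. 0 \<partial>P)"
    unfolding correlation_measure_def
  proof (rule nn_integral_cong_AE)
    show "AE \<omega> in P. emeasure (count_space UNIV)
       {ks :: (nat + nat) list. length ks = n \<and> distinct ks \<and> set ks \<subseteq> pp_index \<omega> \<and>
          map (pp_point \<omega>) ks \<in> diagonal_set n} = 0"
      using simple
    proof eventually_elim
      case (elim \<omega>)
      then have "{ks :: (nat + nat) list. length ks = n \<and> distinct ks \<and> set ks \<subseteq> pp_index \<omega> \<and>
          map (pp_point \<omega>) ks \<in> diagonal_set n} = {}"
        using map_pp_point_notin_diagonal_set by auto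
      then show ?case by (simp only: emeasure_empty)
    qed
  qed
  then show "correlation_measure P n (diagonal_set n) = 0" by simp
qed

end
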